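(* Let $K$ be a nonempty compact subset of $X$ and let $f:X\to Y$ be a single-valued mapping. Assume that $K$ is starshaped and that $f$ is $C$-continuous, $-C$-continuous and strictly quasi $C$-convexlike on $K$. Then the set of weakly efficient solutions $W(f,K)$ and the set of efficient solutions $E(f,K)$ are both contractible.
   Context: $X$ is a (real) normed vector space, $Y$ is a (real) Banach space, and $C\subseteq Y$ is a convex, closed, pointed cone with nonempty interior $\operatorname{int}C$. $W(f,K)=\{x\in K: f(y)-f(x)\notin-\operatorname{int}C\ \ \forall y\in K\}$ and $E(f,K)=\{x\in K: f(y)-f(x)\notin -C\setminus\{0\}\ \ \forall y\in K\}$, where $-C\setminus\{0\}$ means $(-C)\setminus\{0\}$. $f$ is $C$-continuous (resp. $-C$-continuous) at $x_0$ if for any neighborhood $V$ of $f(x_0)$ there is a neighborhood $U(x_0)$ of $x_0$ such that $f(x)\in V+C$ (resp. $f(x)\in V-C$) for all $x\in U(x_0)$; it is so on $K$ if it is so at each point of $K$. $f$ is strictly quasi $C$-convexlike on $K$ if for any $x_1,x_2\in K$ with $x_1\neq x_2$ there exist $x_3\in K$ and $\lambda\in[0,1]$ such that $\lambda f(x_1)+(1-\lambda)f(x_2)-f(x_3)\in\operatorname{int}C$. $K$ is starshaped if there is $x_0\in K$ such that $\lambda x_0+(1-\lambda)y\in K$ for all $\lambda\in[0,1]$ and $y\in K$. A nonempty set $A$ in a topological space is contractible if there exist $x_0\in A$ and a continuous mapping $H:A\times[0,1]\to A$ such that $H(x,1)=x$ and $H(x,0)=x_0$ for any $x\in A$. *)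

theory Defs
  imports "HOL-Analysis.Analysis" "HOL-Library.Set_Algebras"
begin

text \<open>
  On sets, unary and binary minus are complement and set difference, so the reflected
  cone is written \<open>uminus ` C\<close>.  The sum \<open>V + C\<close> is the Minkowski sum.
\<close>

definition weakly_efficient :: "'b::real_normed_vector set \<Rightarrow> ('a \<Rightarrow> 'b) \<Rightarrow> 'a set \<Rightarrow> 'a set" where
  "weakly_efficient C f K = {x \<in> K. \<forall>y\<in>K. f y - f x \<notin> uminus ` interior C}"

definition efficient :: "'b::real_normed_vector set \<Rightarrow> ('a \<Rightarrow> 'b) \<Rightarrow> 'a set \<Rightarrow> 'a set" where
  "efficient C f K = {x \<in> K. \<forall>y\<in>K. f y - f x \<notin> uminus ` C - {0}}"

text \<open>
  Neighbourhoods of \<open>x0\<close> are taken in the whole domain space of \<open>f\<close>, not relative to a subset.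
  The \<open>-C\<close>-continuity of \<open>f\<close> is \<open>cone_continuous_on (uminus ` C) K f\<close>.
\<close>

definition cone_continuous_at ::
  "'b::real_normed_vector set \<Rightarrow> 'a::real_normed_vector \<Rightarrow> ('a \<Rightarrow> 'b) \<Rightarrow> bool" where
  "cone_continuous_at C x0 f \<longleftrightarrow>
     (\<forall>V. open V \<and> f x0 \<in> V \<longrightarrow> (\<exists>U. open U \<and> x0 \<in> U \<and> (\<forall>x\<in>U. f x \<in> V + C)))"

definition cone_continuous_on ::
  "'b::real_normed_vector set \<Rightarrow> 'a::real_normed_vector set \<Rightarrow> ('a \<Rightarrow> 'b) \<Rightarrow> bool" where
  "cone_continuous_on C K f \<longleftrightarrow> (\<forall>x0\<in>K. cone_continuous_at C x0 f)"

definition strictly_quasi_convexlike_on ::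
  "'b::real_normed_vector set \<Rightarrow> 'a set \<Rightarrow> ('a \<Rightarrow> 'b) \<Rightarrow> bool" where
  "strictly_quasi_convexlike_on C K f \<longleftrightarrow>
     (\<forall>x1\<in>K. \<forall>x2\<in>K. x1 \<noteq> x2 \<longrightarrow>
        (\<exists>x3\<in>K. \<exists>l\<in>{0..1::real}. l *\<^sub>R f x1 + (1 - l) *\<^sub>R f x2 - f x3 \<in> interior C))"

end

theory Submission
  imports Defs
begin

text \<open>
  Fix \<open>e\<close> in the interior of \<open>C\<close> and let \<open>cone_gauge z\<close> be the least \<open>t\<close> with
  \<open>z \<in> t *\<^sub>R e - C\<close>.  The two cone continuity assumptions make
  \<open>(x, y) \<mapsto> cone_gauge (f y - f x)\<close> continuous on \<open>K \<times> K\<close>, although \<open>f\<close> itself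
  need not be norm continuous when \<open>C\<close> is not normal.  Strict quasi convexlikeness makes
  its minimizer in \<open>y\<close> unique.  That minimizer is weakly efficient and depends continuously
  on \<open>x\<close>, and it is \<open>x\<close> itself if \<open>x\<close> is weakly efficient.  So the weakly efficient set is a
  retract of the contractible set \<open>K\<close>.  Strict quasi convexlikeness also forces weakly
  efficient points to be efficient.
\<close>

section \<open>Continuity of unique minimizers over compact sets\<close>

lemma continuous_on_unique_minimizer:
  fixes h :: "'a::t2_space \<times> 'b::t2_space \<Rightarrow> real"
  assumes "compact S" "compact T" "continuous_on (S \<times> T) h"
    and r: "\<And>x. x \<in> S \<Longrightarrow> r x \<in> T"
    and min: "\<And>x y. x \<in> S \<Longrightarrow> y \<in> T \<Longrightarrow> h (x, r x) \<le> h (x, y)"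
    and uniq: "\<And>x y. x \<in> S \<Longrightarrow> y \<in> T \<Longrightarrow> h (x, y) \<le> h (x, r x) \<Longrightarrow> y = r x"
  shows "continuous_on S r"
proof -
  have "closed (r -` D \<inter> S)" if "closed D" for D
  proof -
    have ST: "compact (S \<times> T)"
      using assms(1,2) by (rule compact_Times)
    have cl: "closed {p \<in> S \<times> T. h p \<le> h (fst p, z)}" if "z \<in> T" for z
    proof (intro continuous_on_closed_Collect_le)
      show "continuous_on (S \<times> T) (\<lambda>p. h (fst p, z))"
        by (rule continuous_on_compose2[OF assms(3)]) (use that in \<open>auto intro!: continuous_intros\<close>)
    qed (use assms(3) ST compact_imp_closed in auto)
    \<comment> \<open>\<open>?B\<close> is the part of the graph of \<open>r\<close> lying over
      \<open>D\<close>: a pair that beats every competitor \<open>z\<close> beats \<open>r x\<close>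
      in particular, so \<open>uniq\<close> applies. It is cut out of a compact product by closed
      conditions, so its projection is compact.\<close>
    have "r -` D \<inter> S = fst ` (S \<times> T \<inter> (snd -` D \<inter> (\<Inter>z\<in>T. {p \<in> S \<times> T. h p \<le> h (fst p, z)})))"
      (is "_ = fst ` ?B")
    proof (intro set_eqI iffI)
      fix x assume x: "x \<in> r -` D \<inter> S"
      then have "(x, r x) \<in> ?B"
        using r min by auto
      then show "x \<in> fst ` ?B"
        by (rule image_eqI[rotated]) simp
    next
      fix x assume "x \<in> fst ` ?B"
      then obtain y where "x \<in> S" "y \<in> T" "y \<in> D" "\<forall>z\<in>T. h (x, y) \<le> h (x, z)"
        by auto
      moreover from this have "y = r x"
        using uniq r by blast
      ultimately show "x \<in> r -` D \<inter> S"
        by auto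
    qed
    moreover have "compact ?B"
      using ST cl \<open>closed D\<close>
      by (intro compact_Int_closed closed_Int closed_INT closed_vimage_snd) auto
    ultimately show ?thesis
      by (simp add: compact_imp_closed compact_continuous_image continuous_on_fst)
  qed
  then show ?thesis
    using continuous_on_closed_vimage[OF compact_imp_closed[OF assms(1)]] by blast
qed

section \<open>Pointwise forms of the definitions\<close>

lemma mem_uminus_image_iff:
  fixes z :: "'b::group_add"
  shows "z \<in> uminus ` S \<longleftrightarrow> - z \<in> S"
  by (metis image_iff minus_minus)

lemma weakly_efficient_iff:
  "x \<in> weakly_efficient C f K \<longleftrightarrow> x \<in> K \<and> (\<forall>y\<in>K. f x - f y \<notin> interior C)"
  by (simp add: weakly_efficient_def mem_uminus_image_iff)

lemma efficient_iff:
  "x \<in> efficient C f K \<longleftrightarrow> x \<in> K \<and> (\<forall>y\<in>K. f x - f y \<in> C \<longrightarrow> f y = f x)"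
  by (auto simp: efficient_def mem_uminus_image_iff)

lemma strictly_quasi_convexlike_onE:
  assumes "strictly_quasi_convexlike_on C K f" "x \<in> K" "y \<in> K" "x \<noteq> y"
  obtains z l where "z \<in> K" "l \<in> {0..1::real}"
    "l *\<^sub>R f x + (1 - l) *\<^sub>R f y - f z \<in> interior C"
  using assms unfolding strictly_quasi_convexlike_on_def by blast

text \<open>For a cone, \<open>proper\<close> says that \<open>C\<close> is not the whole space.
  This is what bounds the gauge in direction \<open>e\<close> from below.\<close>

locale solid_cone =
  fixes C :: "'b::real_normed_vector set" and e :: 'b
  assumes convex: "convex C" and closed: "closed C" and cone: "cone C"
    and unit: "e \<in> interior C"
    and proper: "0 \<notin> interior C"
begin

section \<open>Arithmetic of the cone and its interior\<close>

lemma add_mem: "x \<in> C \<Longrightarrow> y \<in> C \<Longrightarrow> x + y \<in> C"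
  using convex cone convex_cone by blast

lemma scaleR_mem: "x \<in> C \<Longrightarrow> 0 \<le> c \<Longrightarrow> c *\<^sub>R x \<in> C"
  using cone by (auto simp: cone_def)

text \<open>Translating the interior by a vector of \<open>C\<close> gives an open subset of
  \<open>C\<close>.\<close>

lemma interior_add_mem:
  assumes "x \<in> interior C" "y \<in> C"
  shows "x + y \<in> interior C"
proof -
  have "(+) y ` interior C \<subseteq> interior C"
    using add_mem[OF \<open>y \<in> C\<close>] interior_subset
    by (intro interior_maximal open_translation) auto
  then show ?thesis
    using assms(1) by (metis add.commute image_subset_iff)
qed

lemma unit_mem: "e \<in> C"
  using unit interior_subset by blast

lemma minus_unit_notin: "- e \<notin> C"
  using interior_add_mem[OF unit, of "- e"] proper by auto

lemma scaleR_unit_interior: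
  assumes "0 < t"
  shows "t *\<^sub>R e \<in> interior C"
proof -
  have "(*\<^sub>R) t ` interior C \<subseteq> interior C"
    using assms scaleR_mem[of _ t] interior_subset[of C]
    by (intro interior_maximal open_scaling) auto
  then show ?thesis
    using unit by auto
qed

lemma interior_minus_unit:
  assumes "x \<in> interior C"
  obtains d where "0 < d" "x - d *\<^sub>R e \<in> C"
proof -
  have "((\<lambda>d. x - d *\<^sub>R e) \<longlongrightarrow> x - 0 *\<^sub>R e) (at_right 0)"
    by (intro tendsto_intros)
  then have "\<forall>\<^sub>F d in at_right 0. x - d *\<^sub>R e \<in> interior C"
    using assms by (auto elim!: topological_tendstoD)
  then have "\<forall>\<^sub>F d::real in at_right 0. 0 < d \<and> x - d *\<^sub>R e \<in> C"
    using eventually_at_right_less[of "0::real"]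
    by eventually_elim (use interior_subset in blast)
  then show thesis
    using that eventually_happens'[OF trivial_limit_at_right_real] by blast
qed

section \<open>The scalarizing gauge\<close>

lemma absorbing:
  obtains t where "t *\<^sub>R e - z \<in> C"
proof -
  have "((\<lambda>d. e - d *\<^sub>R z) \<longlongrightarrow> e - 0 *\<^sub>R z) (at_right 0)"
    by (intro tendsto_intros)
  then have "\<forall>\<^sub>F d in at_right 0. e - d *\<^sub>R z \<in> interior C"
    using unit by (auto elim!: topological_tendstoD)
  then have "\<forall>\<^sub>F d::real in at_right 0. 0 < d \<and> e - d *\<^sub>R z \<in> C"
    using eventually_at_right_less[of "0::real"]
    by eventually_elim (use interior_subset in blast)
  then obtain d :: real where "0 < d" "e - d *\<^sub>R z \<in> C"
    using eventually_happens'[OF trivial_limit_at_right_real] by blast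
  then have "inverse d *\<^sub>R (e - d *\<^sub>R z) \<in> C"
    by (intro scaleR_mem) auto
  then show thesis
    using that[of "inverse d"] \<open>0 < d\<close> by (simp add: algebra_simps)
qed

text \<open>This is the Gerstewitz (Tammer) scalarization functional of \<open>C\<close> in
  direction \<open>e\<close>.\<close>

definition cone_gauge :: "'b \<Rightarrow> real" where
  "cone_gauge z = Inf {t. t *\<^sub>R e - z \<in> C}"

text \<open>The admissible \<open>t\<close> form a closed set, nonempty by \<open>absorbing\<close>
  and bounded below, so the infimum is attained. Larger \<open>t\<close> stay admissible because
  \<open>e\<close> lies in \<open>C\<close>.\<close>

lemma cone_gauge_le_iff: "cone_gauge z \<le> t \<longleftrightarrow> t *\<^sub>R e - z \<in> C"
proof -
  let ?T = "{t. t *\<^sub>R e - z \<in> C}"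
  \<comment> \<open>Here \<open>s\<close> is admissible for \<open>- z\<close>. Adding the two
    memberships gives \<open>(s + t) *\<^sub>R e \<in> C\<close>; if \<open>s + t\<close> were
    negative, rescaling would put \<open>- e\<close> into \<open>C\<close>.\<close>
  obtain s where s: "s *\<^sub>R e - (- z) \<in> C"
    using absorbing .
  have "- s \<le> t" if "t \<in> ?T" for t
  proof (rule ccontr)
    assume "\<not> - s \<le> t"
    moreover have "(s + t) *\<^sub>R e \<in> C"
      using add_mem[OF s, of "t *\<^sub>R e - z"] that by (simp add: algebra_simps)
    ultimately have "(1 / - (s + t)) *\<^sub>R ((s + t) *\<^sub>R e) \<in> C"
      using scaleR_mem[of "(s + t) *\<^sub>R e" "1 / - (s + t)"] by auto
    moreover have "(1 / - (s + t)) *\<^sub>R ((s + t) *\<^sub>R e) = - e"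
    proof -
      have "1 / - (s + t) * (s + t) = - 1"
        using \<open>\<not> - s \<le> t\<close> by (simp add: divide_simps)
      then show ?thesis
        by (simp only: scaleR_scaleR scaleR_minus_left scaleR_one)
    qed
    ultimately show False
      using minus_unit_notin by simp
  qed
  then have bdd: "bdd_below ?T"
    by (rule bdd_belowI)
  have "closed ((\<lambda>t. t *\<^sub>R e - z) -` C)"
    by (intro continuous_closed_vimage closed continuous_intros)
  then have "closed ?T"
    by (simp add: vimage_def)
  moreover have "?T \<noteq> {}"
    using absorbing[of z] by blast
  ultimately have attained: "cone_gauge z *\<^sub>R e - z \<in> C"
    using closed_contains_Inf[of ?T] bdd by (simp add: cone_gauge_def)
  show ?thesis
  proof
    assume "cone_gauge z \<le> t"
    then have "(t - cone_gauge z) *\<^sub>R e \<in> C"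
      by (intro scaleR_mem unit_mem) auto
    from add_mem[OF this attained] show "t *\<^sub>R e - z \<in> C"
      by (simp add: algebra_simps)
  next
    assume "t *\<^sub>R e - z \<in> C"
    then show "cone_gauge z \<le> t"
      unfolding cone_gauge_def using bdd by (intro cInf_lower) auto
  qed
qed

lemma cone_gauge_mem: "cone_gauge z *\<^sub>R e - z \<in> C"
  using cone_gauge_le_iff by blast

text \<open>A gap between the gauge and \<open>t\<close> contributes a positive multiple of
  \<open>e\<close>, which is interior. Conversely, an interior point can give up some
  \<open>d *\<^sub>R e\<close> without leaving \<open>C\<close>.\<close>

lemma cone_gauge_less_iff: "cone_gauge z < t \<longleftrightarrow> t *\<^sub>R e - z \<in> interior C"
proof
  assume "cone_gauge z < t"
  then have "(t - cone_gauge z) *\<^sub>R e \<in> interior C"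
    by (intro scaleR_unit_interior) auto
  from interior_add_mem[OF this cone_gauge_mem[of z]] show "t *\<^sub>R e - z \<in> interior C"
    by (simp add: algebra_simps)
next
  assume "t *\<^sub>R e - z \<in> interior C"
  then obtain d where "0 < d" "t *\<^sub>R e - z - d *\<^sub>R e \<in> C"
    using interior_minus_unit by blast
  then have "cone_gauge z \<le> t - d"
    unfolding cone_gauge_le_iff by (simp add: algebra_simps)
  with \<open>0 < d\<close> show "cone_gauge z < t"
    by simp
qed

lemma cone_gauge_zero: "cone_gauge 0 = 0"
  using cone_gauge_le_iff[of 0 0] cone_gauge_less_iff[of 0 0] proper scaleR_mem[OF unit_mem, of 0]
  by simp

text \<open>This replaces a Lipschitz bound: closeness is measured by the cone order and multiples
  of \<open>e\<close>, not by the norm.\<close>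

lemma cone_gauge_le_add:
  assumes "z + s *\<^sub>R e - z' \<in> C"
  shows "cone_gauge z' \<le> cone_gauge z + s"
  using add_mem[OF assms cone_gauge_mem[of z]] by (simp add: cone_gauge_le_iff algebra_simps)

section \<open>Cone continuity as order estimates along \<open>e\<close>\<close>

lemma cone_continuous_lower:
  assumes "cone_continuous_at C x f" "0 < d"
  shows "\<forall>\<^sub>F y in nhds x. f y + d *\<^sub>R e - f x \<in> C"
proof -
  \<comment> \<open>This open set contains \<open>f x\<close> because \<open>d *\<^sub>R e\<close>
    is interior, and adding vectors of \<open>C\<close> preserves its defining condition.\<close>
  let ?V = "(\<lambda>v. v + d *\<^sub>R e - f x) -` interior C"
  have "open ?V"
    by (intro open_vimage continuous_intros) auto
  moreover have "f x \<in> ?V"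
    using scaleR_unit_interior[OF \<open>0 < d\<close>] by simp
  ultimately obtain U where "open U" "x \<in> U" and U: "\<forall>y\<in>U. f y \<in> ?V + C"
    using assms(1) unfolding cone_continuous_at_def by meson
  have "f y + d *\<^sub>R e - f x \<in> C" if "y \<in> U" for y
  proof -
    from bspec[OF U that] obtain v c where "f y = v + c" "v \<in> ?V" "c \<in> C"
      by (rule set_plus_elim)
    moreover from this have "v + d *\<^sub>R e - f x + c \<in> C"
      by (intro add_mem) (use interior_subset in auto)
    ultimately show ?thesis
      by (simp add: algebra_simps)
  qed
  with \<open>open U\<close> \<open>x \<in> U\<close> show ?thesis
    unfolding eventually_nhds by blast
qed

lemma cone_continuous_upper:
  assumes "cone_continuous_at (uminus ` C) x f" "0 < d"
  shows "\<forall>\<^sub>F y in nhds x. f x + d *\<^sub>R e - f y \<in> C"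
proof -
  let ?V = "(\<lambda>v. f x + d *\<^sub>R e - v) -` interior C"
  have "open ?V"
    by (intro open_vimage continuous_intros) auto
  moreover have "f x \<in> ?V"
    using scaleR_unit_interior[OF \<open>0 < d\<close>] by simp
  ultimately obtain U where "open U" "x \<in> U" and U: "\<forall>y\<in>U. f y \<in> ?V + uminus ` C"
    using assms(1) unfolding cone_continuous_at_def by meson
  have "f x + d *\<^sub>R e - f y \<in> C" if "y \<in> U" for y
  proof -
    obtain v c where "v \<in> ?V" "c \<in> C" "f y = v - c"
    proof -
      from bspec[OF U \<open>y \<in> U\<close>]
      obtain v w where "f y = v + w" "v \<in> ?V" "w \<in> uminus ` C"
        by (rule set_plus_elim)
      then show thesis
        using that[of v "- w"] by auto
    qed
    then have "f x + d *\<^sub>R e - v + c \<in> C"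
      by (intro add_mem) (use interior_subset in auto)
    then show ?thesis
      by (simp add: \<open>f y = v - c\<close> algebra_simps)
  qed
  with \<open>open U\<close> \<open>x \<in> U\<close> show ?thesis
    unfolding eventually_nhds by blast
qed

lemma continuous_on_cone_gauge_diff:
  assumes "cone_continuous_on C K f" "cone_continuous_on (uminus ` C) K f"
  shows "continuous_on (K \<times> K) (\<lambda>(x, y). cone_gauge (f y - f x))"
  unfolding continuous_on_def
proof (intro ballI)
  fix p assume "p \<in> K \<times> K"
  then obtain a b where p: "p = (a, b)" "a \<in> K" "b \<in> K"
    by blast
  have "\<forall>\<^sub>F q in nhds a \<times>\<^sub>F nhds b. dist (cone_gauge (f (snd q) - f (fst q))) (cone_gauge (f b - f a)) < d"
    if "0 < d" for d
  proof -
    \<comment> \<open>Each of the two arguments may move the difference by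
      \<open>?d *\<^sub>R e\<close>, so the gauge changes by at most \<open>d / 2\<close>, strictly
      less than \<open>d\<close>.\<close>
    let ?d = "d / 4"
    have near: "\<forall>\<^sub>F y in nhds x. f y + ?d *\<^sub>R e - f x \<in> C \<and> f x + ?d *\<^sub>R e - f y \<in> C"
      if "x \<in> K" for x
      using assms that \<open>0 < d\<close> unfolding cone_continuous_on_def
      by (intro eventually_conj cone_continuous_lower cone_continuous_upper) auto
    have "\<forall>\<^sub>F q in nhds a \<times>\<^sub>F nhds b.
        (f (fst q) + ?d *\<^sub>R e - f a \<in> C \<and> f a + ?d *\<^sub>R e - f (fst q) \<in> C) \<and>
        (f (snd q) + ?d *\<^sub>R e - f b \<in> C \<and> f b + ?d *\<^sub>R e - f (snd q) \<in> C)"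
      using eventually_prodI[OF near[OF p(2)] near[OF p(3)]] .
    then show ?thesis
    proof eventually_elim
      case (elim q)
      have half: "(d / 2) *\<^sub>R e = ?d *\<^sub>R e + ?d *\<^sub>R e"
        by (simp flip: scaleR_add_left)
      have "cone_gauge (f (snd q) - f (fst q)) \<le> cone_gauge (f b - f a) + d / 2"
      proof (rule cone_gauge_le_add)
        show "f b - f a + (d / 2) *\<^sub>R e - (f (snd q) - f (fst q)) \<in> C"
          using add_mem[of "f (fst q) + ?d *\<^sub>R e - f a" "f b + ?d *\<^sub>R e - f (snd q)"] elim
          unfolding half by (simp add: algebra_simps)
      qed
      moreover have "cone_gauge (f b - f a) \<le> cone_gauge (f (snd q) - f (fst q)) + d / 2"
      proof (rule cone_gauge_le_add)
        show "f (snd q) - f (fst q) + (d / 2) *\<^sub>R e - (f b - f a) \<in> C"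
          using add_mem[of "f a + ?d *\<^sub>R e - f (fst q)" "f (snd q) + ?d *\<^sub>R e - f b"] elim
          unfolding half by (simp add: algebra_simps)
      qed
      ultimately show ?case
        using \<open>0 < d\<close> by (simp add: dist_real_def abs_le_iff)
    qed
  qed
  \<comment> \<open>Cone continuity uses neighbourhoods in the whole space, so the limit holds along
    all of \<open>nhds p\<close> and is then restricted to \<open>K \<times> K\<close>.\<close>
  then have "((\<lambda>q. cone_gauge (f (snd q) - f (fst q))) \<longlongrightarrow> cone_gauge (f b - f a)) (nhds p)"
    unfolding p nhds_prod by (rule tendstoI)
  then show "((\<lambda>(x, y). cone_gauge (f y - f x)) \<longlongrightarrow> (case p of (x, y) \<Rightarrow> cone_gauge (f y - f x)))
      (at p within K \<times> K)"
    unfolding p case_prod_beta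
    by (auto intro: tendsto_mono[OF at_within_le_nhds])
qed

section \<open>Weakly efficient and efficient solutions\<close>

lemma weakly_efficient_eq_efficient:
  assumes sqc: "strictly_quasi_convexlike_on C K f"
  shows "weakly_efficient C f K = efficient C f K"
proof (intro set_eqI iffI)
  fix x assume "x \<in> weakly_efficient C f K"
  then have "x \<in> K" and weff: "\<And>y. y \<in> K \<Longrightarrow> f x - f y \<notin> interior C"
    by (auto simp: weakly_efficient_iff)
  have "f y = f x" if "y \<in> K" "f x - f y \<in> C" for y
  proof (rule ccontr)
    assume "f y \<noteq> f x"
    then obtain z l where z: "z \<in> K" "l \<in> {0..1}"
      "l *\<^sub>R f x + (1 - l) *\<^sub>R f y - f z \<in> interior C"
      using strictly_quasi_convexlike_onE[OF sqc \<open>x \<in> K\<close> \<open>y \<in> K\<close>] by metis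
    \<comment> \<open>Adding this to the interior vector from \<open>z(3)\<close> cancels
      \<open>f y\<close> and leaves \<open>f x - f z\<close>.\<close>
    have "(1 - l) *\<^sub>R (f x - f y) \<in> C"
      using z that by (intro scaleR_mem) auto
    from interior_add_mem[OF z(3) this] have "f x - f z \<in> interior C"
      by (simp add: algebra_simps)
    with weff[OF z(1)] show False ..
  qed
  with \<open>x \<in> K\<close> show "x \<in> efficient C f K"
    by (simp add: efficient_iff)
next
  fix x assume "x \<in> efficient C f K"
  then have "x \<in> K" and eff: "\<And>y. y \<in> K \<Longrightarrow> f x - f y \<in> C \<Longrightarrow> f y = f x"
    by (auto simp: efficient_iff)
  have "f x - f y \<notin> interior C" if "y \<in> K" for y
  proof
    assume *: "f x - f y \<in> interior C"
    then have "f y = f x"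
      using eff[OF that] interior_subset by blast
    with * proper show False
      by simp
  qed
  with \<open>x \<in> K\<close> show "x \<in> weakly_efficient C f K"
    by (simp add: weakly_efficient_iff)
qed

lemma weakly_efficient_retract:
  assumes "K \<noteq> {}" "compact K"
    and cont: "cone_continuous_on C K f" "cone_continuous_on (uminus ` C) K f"
    and sqc: "strictly_quasi_convexlike_on C K f"
  shows "weakly_efficient C f K \<noteq> {}" "weakly_efficient C f K retract_of K"
proof -
  let ?h = "\<lambda>(x, y). cone_gauge (f y - f x)"
  have h: "continuous_on (K \<times> K) ?h"
    using cont by (rule continuous_on_cone_gauge_diff)
  have "\<exists>y\<in>K. \<forall>z\<in>K. cone_gauge (f y - f x) \<le> cone_gauge (f z - f x)" if "x \<in> K" for x
  proof (rule continuous_attains_inf)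
    have "continuous_on K (\<lambda>y. ?h (x, y))"
      by (rule continuous_on_compose2[OF h]) (use that in \<open>auto intro!: continuous_intros\<close>)
    then show "continuous_on K (\<lambda>y. cone_gauge (f y - f x))"
      by simp
  qed (use assms in auto)
  then obtain r where r: "\<And>x. x \<in> K \<Longrightarrow> r x \<in> K"
    and min: "\<And>x z. x \<in> K \<Longrightarrow> z \<in> K \<Longrightarrow> cone_gauge (f (r x) - f x) \<le> cone_gauge (f z - f x)"
    using bchoice[of K "\<lambda>x y. y \<in> K \<and> (\<forall>z\<in>K. cone_gauge (f y - f x) \<le> cone_gauge (f z - f x))"]
    by blast
  have uniq: "y = r x"
    if "x \<in> K" "y \<in> K" and le: "cone_gauge (f y - f x) \<le> cone_gauge (f (r x) - f x)" for x y
  proof (rule ccontr)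
    let ?m = "cone_gauge (f (r x) - f x)"
    assume "y \<noteq> r x"
    then obtain z l where z: "z \<in> K" "l \<in> {0..1}"
      "l *\<^sub>R f y + (1 - l) *\<^sub>R f (r x) - f z \<in> interior C"
      using strictly_quasi_convexlike_onE[OF sqc \<open>y \<in> K\<close> r[OF \<open>x \<in> K\<close>]] by blast
    \<comment> \<open>Both minimizers satisfy the bound \<open>?m\<close>, hence so does the convex
      combination of their values. As \<open>f z\<close> lies strictly below that combination, its
      gauge would beat the minimum.\<close>
    have "l *\<^sub>R (?m *\<^sub>R e - (f y - f x)) + (1 - l) *\<^sub>R (?m *\<^sub>R e - (f (r x) - f x)) \<in> C"
      using z(2) le cone_gauge_mem by (intro add_mem scaleR_mem) (auto simp: cone_gauge_le_iff)
    from interior_add_mem[OF z(3) this] have "?m *\<^sub>R e - (f z - f x) \<in> interior C"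
      by (simp add: algebra_simps)
    then show False
      using min[OF \<open>x \<in> K\<close> z(1)] by (simp flip: cone_gauge_less_iff)
  qed
  have "continuous_on K r"
    using min uniq by (intro continuous_on_unique_minimizer[OF assms(2,2) h r]) auto
  moreover have r_weff: "r x \<in> weakly_efficient C f K" if "x \<in> K" for x
  proof -
    \<comment> \<open>A strict improvement on \<open>f (r x)\<close> in the cone order would
      strictly lower the gauge.\<close>
    have "f (r x) - f y \<notin> interior C" if "y \<in> K" for y
    proof
      assume "f (r x) - f y \<in> interior C"
      from interior_add_mem[OF this cone_gauge_mem[of "f (r x) - f x"]]
      have "cone_gauge (f y - f x) < cone_gauge (f (r x) - f x)"
        by (simp add: cone_gauge_less_iff algebra_simps)
      with min[OF \<open>x \<in> K\<close> \<open>y \<in> K\<close>] show False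
        by simp
    qed
    with r[OF that] show ?thesis
      by (simp add: weakly_efficient_iff)
  qed
  moreover have "r x = x" if x: "x \<in> weakly_efficient C f K" for x
  proof -
    have "x \<in> K" and weff: "\<And>y. y \<in> K \<Longrightarrow> f x - f y \<notin> interior C"
      using x by (auto simp: weakly_efficient_iff)
    \<comment> \<open>Weak efficiency makes the minimum nonnegative, while the candidate
      \<open>x\<close> itself attains 0. So \<open>x\<close> ties with \<open>r x\<close>, and
      uniqueness identifies them.\<close>
    have "0 \<le> cone_gauge (f (r x) - f x)"
      using weff[OF r[OF \<open>x \<in> K\<close>]] cone_gauge_less_iff[of "f (r x) - f x" 0] by simp
    then show ?thesis
      using uniq[OF \<open>x \<in> K\<close> \<open>x \<in> K\<close>] by (simp add: cone_gauge_zero)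
  qed
  moreover have "weakly_efficient C f K \<subseteq> K"
    by (auto simp: weakly_efficient_iff)
  ultimately show "weakly_efficient C f K retract_of K"
    unfolding retract_of_def retraction_def by blast
  show "weakly_efficient C f K \<noteq> {}"
    using r_weff \<open>K \<noteq> {}\<close> by blast
qed

end

theorem theorem6p1:
  fixes f :: "'a::real_normed_vector \<Rightarrow> 'b::banach"
    and C :: "'b set"
    and K :: "'a set"
  assumes nontrivial: "(UNIV :: 'b set) \<noteq> {0}"
    and "convex C" and "closed C" and "cone C"
    and pointed: "C \<inter> uminus ` C = {0}"
    and "interior C \<noteq> {}"
    and "K \<noteq> {}" and "compact K" and "starlike K"
    and "cone_continuous_on C K f"
    and "cone_continuous_on (uminus ` C) K f"
    and "strictly_quasi_convexlike_on C K f"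
  shows "(weakly_efficient C f K \<noteq> {} \<and> contractible (weakly_efficient C f K)) \<and>
         (efficient C f K \<noteq> {} \<and> contractible (efficient C f K))"
proof -
  obtain e where "e \<in> interior C"
    using \<open>interior C \<noteq> {}\<close> by blast
  \<comment> \<open>An interior 0 would let scaling reach every vector, giving
    \<open>C = UNIV\<close>; pointedness would then collapse the space to 0.\<close>
  moreover have "0 \<notin> interior C"
  proof
    assume "0 \<in> interior C"
    then obtain d where "0 < d" and d: "ball 0 d \<subseteq> C"
      by (meson mem_interior)
    have "x \<in> C" for x
    proof (cases "x = 0")
      case False
      \<comment> \<open>The factor makes \<open>t *\<^sub>R x\<close> have norm
        \<open>d / 2\<close>, inside the ball.\<close>
      define t where "t = d / (2 * norm x)"
      have "0 < t"
        using False \<open>0 < d\<close> by (simp add: t_def)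
      have "t *\<^sub>R x \<in> ball 0 d"
        using False \<open>0 < d\<close> by (simp add: t_def)
      then have "inverse t *\<^sub>R t *\<^sub>R x \<in> C"
        using d \<open>cone C\<close> \<open>0 < t\<close> unfolding cone_def by (meson inverse_nonnegative_iff_nonnegative less_imp_le subsetD)
      with \<open>0 < t\<close> show ?thesis
        by simp
    qed (use pointed in blast)
    then have "C = UNIV"
      by blast
    with pointed have "(UNIV :: 'b set) = {0}"
      by (metis Int_UNIV_left surj_uminus)
    with nontrivial show False ..
  qed
  ultimately interpret solid_cone C e
    using assms by unfold_locales
  have "weakly_efficient C f K \<noteq> {}" "weakly_efficient C f K retract_of K"
    using weakly_efficient_retract[OF assms(7,8,10,11,12)] .
  moreover have "contractible K"
    using \<open>starlike K\<close> by (rule starlike_imp_contractible)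
  ultimately show ?thesis
    using retract_of_contractible weakly_efficient_eq_efficient[OF assms(12)] by auto
qed

end
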